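(* The class of cycles (graphs isomorphic to $C_m$ for some $m\ge3$) has no $2$ adaptive hom algorithm.
   Context: Graphs are finite, simple, undirected, with non-empty vertex set; classes are closed under isomorphism; $\textsc{Graph}$ is the class of all graphs; $C_m$ is the cycle on $m$ vertices. $\hom(F,G)$ is the number of homomorphisms from $F$ to $G$. For $k\ge1$, a $k$ adaptive hom algorithm for a class $\mathcal C$ consists of a graph $F$, a function $N:\bigcup_{i\in[k-1]}\mathbb N^i\to\textsc{Graph}$, and a set $X\subseteq\mathbb N^k$ such that for all graphs $G$: $G\in\mathcal C\iff(n_1,\dots,n_k)\in X$, where $n_1:=\hom(F,G)$ and $n_{j+1}:=\hom(N(n_1,\dots,n_j),G)$ for $j\in[k-1]$. *)

theory Defs
  imports "Graph_Theory.Graph_Theory" "HOL-Library.FuncSet"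
begin

text \<open>A finite simple undirected graph is a \<open>pair_graph\<close>: finite vertex set, symmetric loop-free set
  of ordered pairs, so that an edge \<open>{u, v}\<close> is present as both \<open>(u, v)\<close> and \<open>(v, u)\<close>.\<close>

definition simple_graph :: "'a pair_pre_digraph \<Rightarrow> bool" where
  "simple_graph G \<longleftrightarrow> pair_graph G \<and> pverts G \<noteq> {}"

text \<open>Homomorphisms are extensional functions, so that each one is counted exactly once.\<close>

definition graph_homs :: "'a pair_pre_digraph \<Rightarrow> 'b pair_pre_digraph \<Rightarrow> ('a \<Rightarrow> 'b) set" where
  "graph_homs F G =
     {f \<in> pverts F \<rightarrow>\<^sub>E pverts G. \<forall>u v. (u, v) \<in> parcs F \<longrightarrow> (f u, f v) \<in> parcs G}"

definition hom_count :: "'a pair_pre_digraph \<Rightarrow> 'b pair_pre_digraph \<Rightarrow> nat" where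
  "hom_count F G = card (graph_homs F G)"

text \<open>The list \<open>[n\<^sub>1, \<dots>, n\<^sub>k]\<close> with \<open>n\<^sub>1 = hom(F, G)\<close> and
  \<open>n\<^sub>j\<^sub>+\<^sub>1 = hom(N(n\<^sub>1, \<dots>, n\<^sub>j), G)\<close> for \<open>1 \<le> j < k\<close>.\<close>

fun hom_answers ::
  "'a pair_pre_digraph \<Rightarrow> (nat list \<Rightarrow> 'a pair_pre_digraph) \<Rightarrow> 'b pair_pre_digraph \<Rightarrow> nat \<Rightarrow> nat list"
where
  "hom_answers F N G 0 = []"
| "hom_answers F N G (Suc 0) = [hom_count F G]"
| "hom_answers F N G (Suc (Suc j)) =
     (let ns = hom_answers F N G (Suc j) in ns @ [hom_count (N ns) G])"

text \<open>Every finite graph has an isomorphic copy with vertices in \<open>nat\<close>, so the class of all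
  graphs is represented by the simple graphs over \<open>nat\<close>. Tuples are lists; \<open>N\<close> is constrained
  and used only on lists of length \<open>1, \<dots>, k - 1\<close>.\<close>

definition adaptive_hom_algorithm ::
  "nat \<Rightarrow> nat pair_pre_digraph set \<Rightarrow> nat pair_pre_digraph \<Rightarrow>
    (nat list \<Rightarrow> nat pair_pre_digraph) \<Rightarrow> nat list set \<Rightarrow> bool" where
  "adaptive_hom_algorithm k \<C> F N X \<longleftrightarrow>
     k \<ge> 1 \<and> simple_graph F \<and>
     (\<forall>ns. 1 \<le> length ns \<and> length ns \<le> k - 1 \<longrightarrow> simple_graph (N ns)) \<and>
     X \<subseteq> {ns. length ns = k} \<and>
     (\<forall>G. simple_graph G \<longrightarrow> (G \<in> \<C> \<longleftrightarrow> hom_answers F N G k \<in> X))"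

definition cycle_graph :: "nat \<Rightarrow> nat pair_pre_digraph" where
  "cycle_graph m =
     \<lparr>pverts = {..<m},
      parcs = {(u, v). u < m \<and> v < m \<and> (v = (u + 1) mod m \<or> u = (v + 1) mod m)}\<rparr>"

definition cycle_class :: "nat pair_pre_digraph set" where
  "cycle_class =
     {G. simple_graph G \<and> (\<exists>m\<ge>3. digraph_iso (with_proj (cycle_graph m)) (with_proj G))}"

lemma simple_graph_iff:
  "simple_graph G \<longleftrightarrow>
     finite (pverts G) \<and> pverts G \<noteq> {} \<and> parcs G \<subseteq> pverts G \<times> pverts G \<and>
     sym (parcs G) \<and> irrefl (parcs G)"
proof
  assume "simple_graph G"
  then interpret pair_graph G by (simp add: simple_graph_def)
  show "finite (pverts G) \<and> pverts G \<noteq> {} \<and> parcs G \<subseteq> pverts G \<times> pverts G \<and>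
     sym (parcs G) \<and> irrefl (parcs G)"
    using \<open>simple_graph G\<close> pair_finite_verts in_arcsD1 in_arcsD2 pair_sym_arcs pair_no_loops
    by (fastforce simp: simple_graph_def symmetric_def irrefl_def)
next
  assume *: "finite (pverts G) \<and> pverts G \<noteq> {} \<and> parcs G \<subseteq> pverts G \<times> pverts G \<and>
     sym (parcs G) \<and> irrefl (parcs G)"
  then have "finite (parcs G)" by (meson finite_SigmaI finite_subset)
  with * have "pair_graph G"
    by unfold_locales (auto simp: symmetric_def irrefl_def)
  with * show "simple_graph G" by (simp add: simple_graph_def)
qed

lemma simple_graph_cycle_graph:
  assumes "m \<ge> 3" shows "simple_graph (cycle_graph m)"
  using assms
  by (auto simp: simple_graph_iff cycle_graph_def sym_def irrefl_def mod_Suc lessThan_empty_iff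
    split: if_splits)

lemma digraph_iso_with_proj_iff:
  assumes "simple_graph G" "simple_graph H"
  shows "digraph_iso (with_proj G) (with_proj H) \<longleftrightarrow>
     (\<exists>f. bij_betw f (pverts G) (pverts H) \<and>
       (\<forall>u\<in>pverts G. \<forall>v\<in>pverts G. (u, v) \<in> parcs G \<longleftrightarrow> (f u, f v) \<in> parcs H))"
    (is "?L \<longleftrightarrow> ?R")
proof
  have G: "parcs G \<subseteq> pverts G \<times> pverts G" and H: "parcs H \<subseteq> pverts H \<times> pverts H"
    using assms by (auto simp: simple_graph_iff)
  {
    assume ?L
    then obtain h where h: "pre_digraph.digraph_isomorphism (with_proj G) h"
      and eq: "with_proj H = app_iso h (with_proj G)"
      by (auto simp: digraph_iso_def)
    have v: "pverts H = iso_verts h ` pverts G" and a: "parcs H = iso_arcs h ` parcs G"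
      and t: "iso_tail h = fst" and hd: "iso_head h = snd"
      using eq by (simp_all add: with_proj_def app_iso_def)
    have inj: "inj_on (iso_verts h) (pverts G)"
      and ar: "\<And>e. e \<in> parcs G \<Longrightarrow> iso_arcs h e = (iso_verts h (fst e), iso_verts h (snd e))"
      using h t hd by (auto simp: pre_digraph.digraph_isomorphism_def prod_eq_iff)
    have "(u, v) \<in> parcs G \<longleftrightarrow> (iso_verts h u, iso_verts h v) \<in> parcs H"
      if "u \<in> pverts G" "v \<in> pverts G" for u v
    proof
      assume "(u, v) \<in> parcs G"
      then show "(iso_verts h u, iso_verts h v) \<in> parcs H"
        using ar[of "(u, v)"] a by (metis fst_conv snd_conv imageI)
    next
      assume "(iso_verts h u, iso_verts h v) \<in> parcs H"
      then obtain e where e: "e \<in> parcs G" "iso_arcs h e = (iso_verts h u, iso_verts h v)"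
        using a by auto
      then have "iso_verts h (fst e) = iso_verts h u" "iso_verts h (snd e) = iso_verts h v"
        using ar by auto
      moreover have "fst e \<in> pverts G" "snd e \<in> pverts G" using e G by auto
      ultimately have "fst e = u" "snd e = v" using inj that by (auto dest: inj_onD)
      then show "(u, v) \<in> parcs G" using e by (cases e) auto
    qed
    then show ?R using inj v by (intro exI[of _ "iso_verts h"]) (auto simp: bij_betw_def)
  next
    assume ?R
    then obtain f where f: "bij_betw f (pverts G) (pverts H)"
      and e: "\<And>u v. u \<in> pverts G \<Longrightarrow> v \<in> pverts G \<Longrightarrow>
        (u, v) \<in> parcs G \<longleftrightarrow> (f u, f v) \<in> parcs H" by blast
    define h where "h = \<lparr>iso_verts = f, iso_arcs = map_prod f f,
      iso_head = (snd :: 'b \<times> 'b \<Rightarrow> 'b), iso_tail = fst\<rparr>"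
    interpret pair_graph G using assms by (simp add: simple_graph_def)
    have wf: "wf_digraph (with_proj G)" by unfold_locales
    have inj: "inj_on (map_prod f f) (parcs G)"
      using f G by (auto simp: bij_betw_def intro: inj_on_subset[OF map_prod_inj_on])
    have "parcs H \<subseteq> map_prod f f ` parcs G"
    proof
      fix p assume p: "p \<in> parcs H"
      then obtain u v where "u \<in> pverts G" "v \<in> pverts G" "p = (f u, f v)"
        using H bij_betw_imp_surj_on[OF f] by (cases p) blast
      then show "p \<in> map_prod f f ` parcs G" using e p by force
    qed
    moreover have "map_prod f f ` parcs G \<subseteq> parcs H" using e G by auto
    ultimately have "with_proj H = app_iso h (with_proj G)"
      using f by (auto simp: with_proj_def app_iso_def h_def bij_betw_def)
    moreover have "pre_digraph.digraph_isomorphism (with_proj G) h"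
      using f inj wf by (auto simp: pre_digraph.digraph_isomorphism_def h_def bij_betw_def)
    ultimately show ?L by (auto simp: digraph_iso_def)
  }
qed

end

theory Submission
  imports Defs "HOL-Number_Theory.Cong"
begin

text \<open>A labelling \<open>s\<close> of the arcs of a graph \<open>G\<close> by integers modulo \<open>k\<close> defines a \<open>k\<close>-sheeted
  cover of \<open>G\<close>. If every homomorphism \<open>F \<rightarrow> G\<close> lifts to this cover, then \<open>F\<close> has as many
  homomorphisms to the cover as to the trivial cover, the disjoint union of \<open>k\<close> copies of \<open>G\<close>: over
  each \<open>F \<rightarrow> G\<close>, adding the sheet numbers of a fixed lift turns lifts to the trivial cover into
  lifts to the given one.

  The cycle \<open>C\<^sub>k\<^sub>m\<close> is such a cover of \<open>C\<^sub>m\<close>, and all homomorphisms \<open>F \<rightarrow> C\<^sub>m\<close> lift to it in two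
  situations: if \<open>F\<close> has fewer than \<open>m\<close> vertices, since \<open>C\<^sub>m\<close> can then be cut at a vertex outside
  the image; and if \<open>F\<close> is bipartite, \<open>k = 2\<close> and \<open>m\<close> is odd, since the sheet can then be read off
  from parities.

  Now let \<open>q\<close> be odd and large. The first query does not distinguish \<open>C\<^sub>6\<^sub>q\<close>, \<open>3 C\<^sub>2\<^sub>q\<close> and
  \<open>2 C\<^sub>3\<^sub>q\<close>, so the second query is the same graph \<open>H\<close> for all three. If \<open>H\<close> is bipartite, it does
  not distinguish \<open>C\<^sub>6\<^sub>q\<close> from \<open>2 C\<^sub>3\<^sub>q\<close>; otherwise it has no homomorphism to the bipartite graphs
  \<open>C\<^sub>6\<^sub>q\<close> and \<open>3 C\<^sub>2\<^sub>q\<close>.\<close>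

subsection \<open>Isomorphism invariance\<close>

abbreviation graph_iso :: "'a pair_pre_digraph \<Rightarrow> 'b pair_pre_digraph \<Rightarrow> bool" where
  "graph_iso G H \<equiv> digraph_iso (with_proj G) (with_proj H)"

lemma graph_isoI:
  assumes "simple_graph G" "simple_graph H" "bij_betw f (pverts G) (pverts H)"
    and "\<And>u v. u \<in> pverts G \<Longrightarrow> v \<in> pverts G \<Longrightarrow> (u, v) \<in> parcs G \<longleftrightarrow> (f u, f v) \<in> parcs H"
  shows "graph_iso G H"
  unfolding digraph_iso_with_proj_iff[OF assms(1,2)] using assms(3,4) by blast

lemma graph_isoE:
  assumes "simple_graph G" "simple_graph H" "graph_iso G H"
  obtains f where "bij_betw f (pverts G) (pverts H)"
    and "\<And>u v. u \<in> pverts G \<Longrightarrow> v \<in> pverts G \<Longrightarrow> (u, v) \<in> parcs G \<longleftrightarrow> (f u, f v) \<in> parcs H"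
  using assms(3) unfolding digraph_iso_with_proj_iff[OF assms(1,2)] by blast

lemma graph_iso_sym:
  assumes "simple_graph G" "graph_iso G H"
  shows "graph_iso H G"
proof -
  interpret pair_graph G using assms(1) by (simp add: simple_graph_def)
  have "wf_digraph (with_proj G)" by unfold_locales
  then show ?thesis using assms(2) by (rule digraph_iso_swap)
qed

lemma graph_iso_nat_copy:
  fixes G :: "'a pair_pre_digraph"
  assumes "simple_graph G"
  obtains H :: "nat pair_pre_digraph" where "simple_graph H" "graph_iso G H"
proof -
  have G: "finite (pverts G)" "pverts G \<noteq> {}" "parcs G \<subseteq> pverts G \<times> pverts G"
    "sym (parcs G)" "irrefl (parcs G)"
    using assms by (auto simp: simple_graph_iff)
  obtain f :: "'a \<Rightarrow> nat" where f: "inj_on f (pverts G)"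
    using finite_imp_inj_to_nat_seg[OF G(1)] by blast
  define H where "H = \<lparr>pverts = f ` pverts G, parcs = map_prod f f ` parcs G\<rparr>"
  have arc: "(f u, f v) \<in> parcs H \<longleftrightarrow> (u, v) \<in> parcs G" if "u \<in> pverts G" "v \<in> pverts G" for u v
    using that G(3) f by (auto simp: H_def dest: inj_onD)
  have "parcs H \<subseteq> pverts H \<times> pverts H"
    using G(3) by (auto simp: H_def)
  moreover have "sym (parcs H)"
    using G(4) by (force simp: H_def sym_def)
  moreover have "irrefl (parcs H)"
    using G(3,5) f by (auto simp: H_def irrefl_def dest: inj_onD)
  ultimately have H: "simple_graph H"
    using G(1,2) by (simp add: simple_graph_iff H_def)
  moreover have "graph_iso G H"
    using assms H f arc by (intro graph_isoI[of _ _ f]) (auto simp: bij_betw_def H_def)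
  ultimately show thesis by (rule that)
qed

lemma finite_graph_homs:
  assumes "simple_graph F" "simple_graph G"
  shows "finite (graph_homs F G)"
proof (rule finite_subset)
  show "graph_homs F G \<subseteq> pverts F \<rightarrow>\<^sub>E pverts G" by (auto simp: graph_homs_def)
  show "finite (pverts F \<rightarrow>\<^sub>E pverts G)"
    using assms by (simp add: simple_graph_iff finite_PiE)
qed

lemma compose_in_graph_homs:
  assumes "simple_graph F" "f \<in> graph_homs F G" "g \<in> graph_homs G H"
  shows "compose (pverts F) g f \<in> graph_homs F H"
  using assms by (fastforce simp: graph_homs_def simple_graph_iff compose_def PiE_iff)

lemma hom_count_le_if_inj_on:
  assumes "simple_graph F" "simple_graph H"
    and g: "g \<in> graph_homs G H" and inj: "inj_on g (pverts G)"
  shows "hom_count F G \<le> hom_count F H"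
  unfolding hom_count_def
proof (rule card_inj_on_le)
  show "compose (pverts F) g ` graph_homs F G \<subseteq> graph_homs F H"
    using compose_in_graph_homs[OF assms(1) _ g] by blast
  show "finite (graph_homs F H)" using assms(1,2) by (rule finite_graph_homs)
  show "inj_on (compose (pverts F) g) (graph_homs F G)"
  proof (rule inj_onI)
    fix f f' assume f: "f \<in> graph_homs F G" and f': "f' \<in> graph_homs F G"
      and eq: "compose (pverts F) g f = compose (pverts F) g f'"
    show "f = f'"
    proof (rule PiE_ext)
      show "f \<in> pverts F \<rightarrow>\<^sub>E pverts G" "f' \<in> pverts F \<rightarrow>\<^sub>E pverts G"
        using f f' by (simp_all add: graph_homs_def)
      fix x assume "x \<in> pverts F"
      then have "g (f x) = g (f' x)" "f x \<in> pverts G" "f' x \<in> pverts G"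
        using f f' fun_cong[OF eq, of x] by (auto simp: graph_homs_def compose_def)
      then show "f x = f' x" by (rule inj_onD[OF inj])
    qed
  qed
qed

lemma hom_count_le_graph_iso:
  assumes "simple_graph F" "simple_graph G" "simple_graph H" "graph_iso G H"
  shows "hom_count F G \<le> hom_count F H"
proof -
  have arcs: "parcs G \<subseteq> pverts G \<times> pverts G" using assms(2) by (simp add: simple_graph_iff)
  obtain f where f: "bij_betw f (pverts G) (pverts H)"
    "\<And>u v. u \<in> pverts G \<Longrightarrow> v \<in> pverts G \<Longrightarrow> (u, v) \<in> parcs G \<longleftrightarrow> (f u, f v) \<in> parcs H"
    using assms(2-4) by (rule graph_isoE) metis
  have "restrict f (pverts G) \<in> graph_homs G H"
    using f arcs by (auto simp: graph_homs_def bij_betw_def)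
  moreover have "inj_on (restrict f (pverts G)) (pverts G)"
    using f(1) by (simp add: bij_betw_def)
  ultimately show ?thesis by (rule hom_count_le_if_inj_on[OF assms(1,3)])
qed

lemma hom_count_graph_iso_cong:
  assumes "simple_graph F" "simple_graph G" "simple_graph H" "graph_iso G H"
  shows "hom_count F G = hom_count F H"
  using hom_count_le_graph_iso[OF assms]
    hom_count_le_graph_iso[OF assms(1,3,2) graph_iso_sym[OF assms(2,4)]]
  by (rule antisym)

definition is_cycle :: "'a pair_pre_digraph \<Rightarrow> bool" where
  "is_cycle G \<longleftrightarrow> (\<exists>m\<ge>3. graph_iso (cycle_graph m) G)"

lemma is_cycle_cycle_graph:
  assumes "m \<ge> 3" shows "is_cycle (cycle_graph m)"
proof -
  have "graph_iso (cycle_graph m) (cycle_graph m)"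
    using simple_graph_cycle_graph[OF assms] by (intro graph_isoI[of _ _ id]) auto
  then show ?thesis using assms by (auto simp: is_cycle_def)
qed

lemma is_cycle_graph_iso:
  assumes "is_cycle G" "graph_iso G H" shows "is_cycle H"
proof -
  obtain m where "m \<ge> 3" "graph_iso (cycle_graph m) G"
    using assms(1) by (auto simp: is_cycle_def)
  moreover from this(2) assms(2) have "graph_iso (cycle_graph m) H" by (rule digraph_iso_trans)
  ultimately show ?thesis by (auto simp: is_cycle_def)
qed

lemma length_hom_answers: "length (hom_answers F N G k) = k"
  by (induction F N G k rule: hom_answers.induct) (simp_all add: Let_def)

lemma hom_answers_graph_iso_cong:
  assumes F: "simple_graph F"
    and N: "\<And>ns. 1 \<le> length ns \<Longrightarrow> length ns \<le> k - 1 \<Longrightarrow> simple_graph (N ns)"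
    and iso: "simple_graph G" "simple_graph H" "graph_iso G H"
  shows "hom_answers F N G k = hom_answers F N H k"
  using N
proof (induction k rule: induct_nat_012)
  case (ge2 j)
  then have "hom_answers F N G (Suc j) = hom_answers F N H (Suc j)" by simp
  moreover have "simple_graph (N (hom_answers F N H (Suc j)))"
    using ge2.prems by (simp add: length_hom_answers)
  ultimately show ?case using iso by (simp add: Let_def hom_count_graph_iso_cong)
qed (simp_all add: hom_count_graph_iso_cong F iso)

lemma is_cycle_iff_hom_answers:
  assumes alg: "adaptive_hom_algorithm k cycle_class F N X" and G: "simple_graph G"
  shows "is_cycle G \<longleftrightarrow> hom_answers F N G k \<in> X"
proof -
  obtain H :: "nat pair_pre_digraph" where H: "simple_graph H" "graph_iso G H"
    using G by (rule graph_iso_nat_copy)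
  have "is_cycle G \<longleftrightarrow> H \<in> cycle_class"
    using is_cycle_graph_iso[OF _ H(2)] is_cycle_graph_iso[OF _ graph_iso_sym[OF G H(2)]] H(1)
    by (auto simp: cycle_class_def is_cycle_def)
  also have "\<dots> \<longleftrightarrow> hom_answers F N H k \<in> X"
    using alg H(1) by (simp add: adaptive_hom_algorithm_def)
  also have "hom_answers F N H k = hom_answers F N G k"
    using alg G H by (intro hom_answers_graph_iso_cong[symmetric])
      (auto simp: adaptive_hom_algorithm_def)
  finally show ?thesis .
qed

subsection \<open>Bipartite graphs\<close>

definition bipartite :: "'a pair_pre_digraph \<Rightarrow> bool" where
  "bipartite G \<longleftrightarrow> (\<exists>c :: 'a \<Rightarrow> bool. \<forall>x y. (x, y) \<in> parcs G \<longrightarrow> c x \<noteq> c y)"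

lemma bipartite_pullback:
  fixes G :: "'b pair_pre_digraph"
  assumes "f \<in> graph_homs F G" "bipartite G"
  shows "bipartite F"
proof -
  obtain c :: "'b \<Rightarrow> bool" where "\<And>x y. (x, y) \<in> parcs G \<Longrightarrow> c x \<noteq> c y"
    using assms(2) unfolding bipartite_def by blast
  then have "\<And>x y. (x, y) \<in> parcs F \<Longrightarrow> (c \<circ> f) x \<noteq> (c \<circ> f) y"
    using assms(1) by (simp add: graph_homs_def)
  then show ?thesis unfolding bipartite_def by blast
qed

lemma hom_count_bipartite_eq_0:
  assumes "\<not> bipartite F" "bipartite G" shows "hom_count F G = 0"
proof -
  have "graph_homs F G = {}" using bipartite_pullback assms by blast
  then show ?thesis by (simp add: hom_count_def)
qed

subsection \<open>Cyclic covers\<close>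

text \<open>The arc from \<open>u\<close> to \<open>v\<close> carries the voltage \<open>s u v - s v u\<close>; the two terms stand on different
  sides of the congruence so that no subtraction is needed and symmetry is automatic.\<close>

definition cyclic_cover ::
  "nat \<Rightarrow> ('v \<Rightarrow> 'v \<Rightarrow> nat) \<Rightarrow> 'v pair_pre_digraph \<Rightarrow> ('v \<times> nat) pair_pre_digraph" where
  "cyclic_cover k s G =
     \<lparr>pverts = pverts G \<times> {..<k},
      parcs = {((u, i), (v, j)). (u, v) \<in> parcs G \<and> i < k \<and> j < k \<and>
        [i + s u v = j + s v u] (mod k)}\<rparr>"

abbreviation disjoint_copies :: "nat \<Rightarrow> 'v pair_pre_digraph \<Rightarrow> ('v \<times> nat) pair_pre_digraph" where
  "disjoint_copies k \<equiv> cyclic_cover k (\<lambda>_ _. 0)"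

definition is_lift ::
  "nat \<Rightarrow> ('v \<Rightarrow> 'v \<Rightarrow> nat) \<Rightarrow> 'a pair_pre_digraph \<Rightarrow> ('a \<Rightarrow> 'v) \<Rightarrow> ('a \<Rightarrow> nat) \<Rightarrow> bool" where
  "is_lift k s F b p \<longleftrightarrow>
     (\<forall>x y. (x, y) \<in> parcs F \<longrightarrow> [p x + s (b x) (b y) = p y + s (b y) (b x)] (mod k))"

abbreviation lifts ::
  "nat \<Rightarrow> ('v \<Rightarrow> 'v \<Rightarrow> nat) \<Rightarrow> 'a pair_pre_digraph \<Rightarrow> ('a \<Rightarrow> 'v) \<Rightarrow> ('a \<Rightarrow> nat) set" where
  "lifts k s F b \<equiv> {p \<in> pverts F \<rightarrow>\<^sub>E {..<k}. is_lift k s F b p}"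

lemma pverts_cyclic_cover [simp]: "pverts (cyclic_cover k s G) = pverts G \<times> {..<k}"
  by (simp add: cyclic_cover_def)

lemma in_parcs_cyclic_cover_iff [simp]:
  "(x, y) \<in> parcs (cyclic_cover k s G) \<longleftrightarrow>
     (fst x, fst y) \<in> parcs G \<and> snd x < k \<and> snd y < k \<and>
     [snd x + s (fst x) (fst y) = snd y + s (fst y) (fst x)] (mod k)"
  by (cases x; cases y) (simp add: cyclic_cover_def)

lemma simple_graph_cyclic_cover:
  assumes "simple_graph G" "k > 0"
  shows "simple_graph (cyclic_cover k s G)"
  using assms
  by (auto simp: simple_graph_iff sym_def irrefl_def lessThan_empty_iff cong_sym_eq)

lemma fst_in_graph_homs_cyclic_cover:
  assumes "simple_graph G"
  shows "restrict fst (pverts (cyclic_cover k s G)) \<in> graph_homs (cyclic_cover k s G) G"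
  using assms by (auto simp: graph_homs_def simple_graph_iff)

lemma bipartite_cyclic_cover:
  assumes "simple_graph G" "bipartite G" shows "bipartite (cyclic_cover k s G)"
  using fst_in_graph_homs_cyclic_cover[OF assms(1)] assms(2) by (rule bipartite_pullback)

lemma hom_count_cyclic_cover:
  fixes F :: "'a pair_pre_digraph" and G :: "'v pair_pre_digraph"
  assumes F: "simple_graph F" and G: "simple_graph G"
  shows "hom_count F (cyclic_cover k s G) = (\<Sum>b\<in>graph_homs F G. card (lifts k s F b))"
proof -
  let ?V = "pverts F"
  let ?pair = "\<lambda>(b, p). \<lambda>x\<in>?V. (b x, p x)"
  let ?unpair = "\<lambda>h. (\<lambda>x\<in>?V. fst (h x), \<lambda>x\<in>?V. snd (h x))"
  have ends: "x \<in> ?V" "y \<in> ?V" if "(x, y) \<in> parcs F" for x y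
    using F that by (auto simp: simple_graph_iff)
  have finite_lifts: "finite (lifts k s F b)" for b
    by (rule finite_subset[OF _ finite_PiE[of ?V "\<lambda>_. {..<k}"]])
      (use F in \<open>auto simp: simple_graph_iff\<close>)
  have "bij_betw ?pair (Sigma (graph_homs F G) (lifts k s F)) (graph_homs F (cyclic_cover k s G))"
  proof (rule bij_betw_byWitness[where f' = ?unpair])
    show "\<forall>bp\<in>Sigma (graph_homs F G) (lifts k s F). ?unpair (?pair bp) = bp"
      by (auto simp: graph_homs_def PiE_def extensional_def fun_eq_iff)
    show "\<forall>h\<in>graph_homs F (cyclic_cover k s G). ?pair (?unpair h) = h"
      by (auto simp: graph_homs_def PiE_def extensional_def fun_eq_iff)
    show "?pair ` Sigma (graph_homs F G) (lifts k s F) \<subseteq> graph_homs F (cyclic_cover k s G)"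
      by (auto simp: graph_homs_def is_lift_def PiE_iff ends)
    show "?unpair ` graph_homs F (cyclic_cover k s G) \<subseteq> Sigma (graph_homs F G) (lifts k s F)"
      by (auto simp: graph_homs_def is_lift_def PiE_iff ends mem_Times_iff)
  qed
  then have "hom_count F (cyclic_cover k s G) = card (Sigma (graph_homs F G) (lifts k s F))"
    unfolding hom_count_def by (rule bij_betw_same_card[symmetric])
  also have "\<dots> = (\<Sum>b\<in>graph_homs F G. card (lifts k s F b))"
    using finite_graph_homs[OF F G] finite_lifts by (intro card_SigmaI ballI)
  finally show ?thesis .
qed

lemma is_lift_add_mod_iff:
  assumes F: "simple_graph F" and p: "is_lift k s F b p"
  shows "is_lift k s F b (\<lambda>x\<in>pverts F. (r x + p x) mod k) \<longleftrightarrow> is_lift k (\<lambda>_ _. 0) F b r"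
proof -
  have "[(r x + p x) mod k + s (b x) (b y) = (r y + p y) mod k + s (b y) (b x)] (mod k) \<longleftrightarrow>
      [r x + 0 = r y + 0] (mod k)"
    if "(x, y) \<in> parcs F" for x y
  proof -
    have "[p x + s (b x) (b y) = p y + s (b y) (b x)] (mod k)"
      using p that by (simp add: is_lift_def)
    then have "[r y + (p x + s (b x) (b y)) = r y + (p y + s (b y) (b x))] (mod k)"
      by (rule cong_add[OF cong_refl])
    then have "[r x + (p x + s (b x) (b y)) = r y + (p y + s (b y) (b x))] (mod k) \<longleftrightarrow>
        [r x + (p x + s (b x) (b y)) = r y + (p x + s (b x) (b y))] (mod k)"
      by (metis cong_sym cong_trans)
    also have "\<dots> \<longleftrightarrow> [r x + 0 = r y + 0] (mod k)"
      by (simp add: cong_add_rcancel_nat)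
    finally show ?thesis
      by (simp add: cong_def mod_add_left_eq add.assoc)
  qed
  moreover have "x \<in> pverts F" "y \<in> pverts F" if "(x, y) \<in> parcs F" for x y
    using F that by (auto simp: simple_graph_iff)
  ultimately show ?thesis unfolding is_lift_def by simp
qed

lemma bij_betw_PiE_add_mod:
  fixes p :: "'a \<Rightarrow> nat"
  assumes "k > 0"
  shows "bij_betw (\<lambda>r. \<lambda>x\<in>V. (r x + p x) mod k) (V \<rightarrow>\<^sub>E {..<k}) (V \<rightarrow>\<^sub>E {..<k})"
proof -
  define neg where "neg x = (k - 1) * p x" for x
  have "neg x + p x = k * p x" for x
    using assms by (cases k) (auto simp: neg_def)
  then have cancel: "((i + p x) mod k + neg x) mod k = i" "((i + neg x) mod k + p x) mod k = i"
    if "i < k" for i x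
    using that by (simp_all add: mod_add_left_eq add.assoc add.commute[of "p x"])
  show ?thesis
    by (rule bij_betw_byWitness[where f' = "\<lambda>r. \<lambda>x\<in>V. (r x + neg x) mod k"])
      (use assms in \<open>auto simp: cancel PiE_iff extensional_def fun_eq_iff\<close>)
qed

lemma card_lifts_eq_trivial_voltage:
  assumes "simple_graph F" "k > 0" "is_lift k s F b p"
  shows "card (lifts k s F b) = card (lifts k (\<lambda>_ _. 0) F b)"
proof -
  have "bij_betw (\<lambda>r. \<lambda>x\<in>pverts F. (r x + p x) mod k)
    (lifts k (\<lambda>_ _. 0) F b) (lifts k s F b)"
    using assms by (intro bij_betw_Collect bij_betw_PiE_add_mod is_lift_add_mod_iff)
  then show ?thesis by (rule bij_betw_same_card[symmetric])
qed

lemma hom_count_cyclic_cover_if_lifts: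
  assumes F: "simple_graph F" and G: "simple_graph G" and k: "k > 0"
    and lift: "\<And>b. b \<in> graph_homs F G \<Longrightarrow> \<exists>p. is_lift k s F b p"
  shows "hom_count F (cyclic_cover k s G) = hom_count F (disjoint_copies k G)"
  unfolding hom_count_cyclic_cover[OF F G]
  using card_lifts_eq_trivial_voltage[OF F k] lift by (intro sum.cong refl) blast

subsection \<open>Cycles as covers\<close>

definition closing_voltage :: "nat \<Rightarrow> nat \<Rightarrow> nat \<Rightarrow> nat" where
  "closing_voltage m u v = (if u + 1 = m \<and> v = 0 then 1 else 0)"

lemma in_parcs_cycle_graph_iff:
  "(u, v) \<in> parcs (cycle_graph m) \<longleftrightarrow> u < m \<and> v < m \<and> (v = (u + 1) mod m \<or> u = (v + 1) mod m)"
  by (simp add: cycle_graph_def)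

lemma simple_graph_cycle_graph_mult:
  assumes "k > 0" "m \<ge> 3" shows "simple_graph (cycle_graph (k * m))"
  using assms mult_le_mono[of 1 k 3 m] by (intro simple_graph_cycle_graph) simp

lemma bipartite_cycle_graph:
  assumes "even m" shows "bipartite (cycle_graph m)"
proof -
  have "even ((x + 1) mod m) \<longleftrightarrow> odd x" for x
    using assms by (simp add: dvd_mod_iff)
  then have "even x \<noteq> even y" if "(x, y) \<in> parcs (cycle_graph m)" for x y
    using that by (auto simp: in_parcs_cycle_graph_iff)
  then show ?thesis unfolding bipartite_def by blast
qed

lemma cyclic_successor_mult_iff:
  fixes m k x y :: nat
  assumes "m > 0"
  shows "y = (x + 1) mod (k * m) \<longleftrightarrow>
    y mod m = (x mod m + 1) mod m \<and>
    y div m = (x div m + closing_voltage m (x mod m) (y mod m)) mod k"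
proof -
  have div: "(x + 1) div m = x div m + closing_voltage m (x mod m) ((x mod m + 1) mod m)"
    using assms by (auto simp: div_Suc mod_Suc closing_voltage_def)
  have "(x + 1) mod (k * m) = m * ((x + 1) div m mod k) + (x mod m + 1) mod m"
    by (metis mod_mult2_eq mult.commute mod_add_left_eq)
  moreover have "y = m * a + c \<longleftrightarrow> y mod m = c \<and> y div m = a" if "c < m" for a c
    using that assms by auto
  ultimately show ?thesis using assms div by (metis mod_less_divisor)
qed

lemma bij_betw_mod_div:
  fixes m k :: nat
  assumes "m > 0"
  shows "bij_betw (\<lambda>x. (x mod m, x div m)) {..<k * m} ({..<m} \<times> {..<k})"
proof (rule bij_betw_byWitness[where f' = "\<lambda>(u, i). m * i + u"])
  have "m * i + u < k * m" if "u < m" "i < k" for u i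
  proof -
    have "m * i + u < m * Suc i" using that by simp
    also have "\<dots> \<le> m * k" using that by (intro mult_le_mono) auto
    finally show ?thesis by (simp add: mult.commute)
  qed
  then show "(\<lambda>(u, i). m * i + u) ` ({..<m} \<times> {..<k}) \<subseteq> {..<k * m}" by auto
qed (use assms in \<open>auto simp: less_mult_imp_div_less\<close>)

lemma graph_iso_cycle_graph_cyclic_cover:
  assumes m: "m \<ge> 3" and k: "k > 0"
  shows "graph_iso (cycle_graph (k * m)) (cyclic_cover k (closing_voltage m) (cycle_graph m))"
proof -
  have succ: "y = (x + 1) mod (k * m) \<longleftrightarrow> y mod m = (x mod m + 1) mod m \<and>
      [x div m + closing_voltage m (x mod m) (y mod m) =
       y div m + closing_voltage m (y mod m) (x mod m)] (mod k)"
    if "x < k * m" "y < k * m" for x y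
  proof (cases "y mod m = (x mod m + 1) mod m")
    case True
    then have "closing_voltage m (y mod m) (x mod m) = 0"
      using m by (auto simp: closing_voltage_def mod_Suc split: if_splits)
    moreover have "y div m < k" using that by (simp add: less_mult_imp_div_less)
    ultimately show ?thesis
      using True m cyclic_successor_mult_iff[of m y x k] by (auto simp: cong_def)
  next
    case False
    then show ?thesis using m cyclic_successor_mult_iff[of m y x k] by simp
  qed
  have arc: "(x, y) \<in> parcs (cycle_graph (k * m)) \<longleftrightarrow>
      ((x mod m, x div m), (y mod m, y div m)) \<in>
        parcs (cyclic_cover k (closing_voltage m) (cycle_graph m))"
    if "x < k * m" "y < k * m" for x y
    using m that succ[OF that] succ[OF that(2,1)]
    by (auto simp: in_parcs_cycle_graph_iff less_mult_imp_div_less cong_sym_eq)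
  have "bij_betw (\<lambda>x. (x mod m, x div m)) (pverts (cycle_graph (k * m)))
      (pverts (cyclic_cover k (closing_voltage m) (cycle_graph m)))"
    using m bij_betw_mod_div[of m k] by (simp add: cycle_graph_def)
  with arc show ?thesis
    using simple_graph_cycle_graph_mult[OF k m]
      simple_graph_cyclic_cover[OF simple_graph_cycle_graph[OF m] k]
    by (intro graph_isoI) (auto simp: cycle_graph_def)
qed

lemma is_cycle_arc_invariant_constant:
  assumes "simple_graph G" "is_cycle G" "u \<in> pverts G" "v \<in> pverts G"
    and const: "\<And>x y. (x, y) \<in> parcs G \<Longrightarrow> g x = g y"
  shows "g u = g v"
proof -
  obtain m where m: "m \<ge> 3" "graph_iso (cycle_graph m) G"
    using assms(2) by (auto simp: is_cycle_def)
  have verts: "pverts (cycle_graph m) = {..<m}" by (simp add: cycle_graph_def)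
  obtain f where f: "bij_betw f {..<m} (pverts G)"
    and arc: "\<And>i j. i \<in> {..<m} \<Longrightarrow> j \<in> {..<m} \<Longrightarrow>
      (i, j) \<in> parcs (cycle_graph m) \<longleftrightarrow> (f i, f j) \<in> parcs G"
    using simple_graph_cycle_graph[OF m(1)] assms(1) m(2) unfolding verts[symmetric]
    by (rule graph_isoE) metis
  have const_f: "g (f i) = g (f 0)" if "i < m" for i
    using that
  proof (induction i)
    case (Suc i)
    then have "(f i, f (Suc i)) \<in> parcs G"
      using arc[of i "Suc i"] by (simp add: in_parcs_cycle_graph_iff)
    from const[OF this] Suc show ?case by simp
  qed simp
  have "g w = g (f 0)" if "w \<in> pverts G" for w
  proof -
    have "w \<in> f ` {..<m}" using that f by (simp add: bij_betw_def)
    then obtain i where "i < m" "w = f i" by auto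
    with const_f show ?thesis by blast
  qed
  from this[OF assms(3)] this[OF assms(4)] show ?thesis by simp
qed

lemma not_is_cycle_disjoint_copies:
  assumes "simple_graph G" "k \<ge> 2" shows "\<not> is_cycle (disjoint_copies k G)"
proof
  assume cycle: "is_cycle (disjoint_copies k G)"
  obtain v where "v \<in> pverts G" using assms(1) by (auto simp: simple_graph_iff)
  then have "(v, 0) \<in> pverts (disjoint_copies k G)" "(v, 1) \<in> pverts (disjoint_copies k G)"
    using assms(2) by auto
  moreover have "snd x = snd y" if "(x, y) \<in> parcs (disjoint_copies k G)" for x y
    using that by (auto simp: cong_def)
  moreover have "simple_graph (disjoint_copies k G)"
    using assms by (intro simple_graph_cyclic_cover) auto
  ultimately have "snd (v, 0 :: nat) = snd (v, 1 :: nat)"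
    using is_cycle_arc_invariant_constant[OF _ cycle] by blast
  then show False by simp
qed

lemma hom_count_cycle_copies_if_lifts:
  assumes F: "simple_graph F" and m: "m \<ge> 3" and k: "k > 0"
    and lift: "\<And>b. b \<in> graph_homs F (cycle_graph m) \<Longrightarrow> \<exists>p. is_lift k (closing_voltage m) F b p"
  shows "hom_count F (disjoint_copies k (cycle_graph m)) = hom_count F (cycle_graph (k * m))"
proof -
  note cycle_m = simple_graph_cycle_graph[OF m]
  have "hom_count F (cycle_graph (k * m)) =
      hom_count F (cyclic_cover k (closing_voltage m) (cycle_graph m))"
    using F simple_graph_cycle_graph_mult[OF k m] simple_graph_cyclic_cover[OF cycle_m k]
      graph_iso_cycle_graph_cyclic_cover[OF m k]
    by (rule hom_count_graph_iso_cong)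
  also have "\<dots> = hom_count F (disjoint_copies k (cycle_graph m))"
    using F cycle_m k lift by (rule hom_count_cyclic_cover_if_lifts)
  finally show ?thesis by (rule sym)
qed

lemma is_lift_closing_voltageI:
  assumes b: "b \<in> graph_homs F (cycle_graph m)" and F: "simple_graph F" and m: "m \<ge> 3"
    and inner: "\<And>x y. (x, y) \<in> parcs F \<Longrightarrow> b y = b x + 1 \<Longrightarrow> [p x = p y] (mod k)"
    and outer: "\<And>x y. (x, y) \<in> parcs F \<Longrightarrow> b x + 1 = m \<Longrightarrow> b y = 0 \<Longrightarrow> [p x + 1 = p y] (mod k)"
  shows "is_lift k (closing_voltage m) F b p"
  unfolding is_lift_def
proof (intro allI impI)
  fix x y assume xy: "(x, y) \<in> parcs F"
  then have yx: "(y, x) \<in> parcs F" using F by (auto simp: simple_graph_iff sym_def)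
  have "(b x, b y) \<in> parcs (cycle_graph m)" using b xy by (simp add: graph_homs_def)
  then consider (forward) "b y = b x + 1" | (backward) "b x = b y + 1"
    | (forward_closing) "b x + 1 = m" "b y = 0"
    | (backward_closing) "b y + 1 = m" "b x = 0"
    by (fastforce simp: in_parcs_cycle_graph_iff mod_Suc split: if_splits)
  then show "[p x + closing_voltage m (b x) (b y) = p y + closing_voltage m (b y) (b x)] (mod k)"
  proof cases
    case forward
    then show ?thesis using inner[OF xy] m by (auto simp: closing_voltage_def)
  next
    case backward
    then show ?thesis using inner[OF yx] m by (auto simp: closing_voltage_def cong_sym_eq)
  next
    case forward_closing
    then show ?thesis using outer[OF xy] m by (simp add: closing_voltage_def)
  next
    case backward_closing
    then show ?thesis using outer[OF yx] m by (simp add: closing_voltage_def cong_sym_eq)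
  qed
qed

lemma is_lift_closing_voltage_if_not_surj:
  assumes "b \<in> graph_homs F (cycle_graph m)" "simple_graph F" "m \<ge> 3"
    and w: "w < m" "w \<notin> b ` pverts F"
  shows "is_lift k (closing_voltage m) F b (\<lambda>x. if b x < w then 1 else 0)"
proof (rule is_lift_closing_voltageI[OF assms(1-3)])
  fix x y assume "(x, y) \<in> parcs F"
  then have "b x \<noteq> w" "b y \<noteq> w"
    using assms(2) w(2) by (auto simp: simple_graph_iff)
  then show "[if b x < w then 1 else 0 = if b y < w then 1 else 0] (mod k)" if "b y = b x + 1"
    using that by auto
  show "[(if b x < w then 1 else 0) + 1 = if b y < w then 1 else 0] (mod k)"
    if "b x + 1 = m" "b y = 0"
    using that \<open>b x \<noteq> w\<close> \<open>b y \<noteq> w\<close> w(1) by auto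
qed

lemma hom_count_cycle_copies_if_card_less:
  assumes F: "simple_graph F" and card: "card (pverts F) < m" and m: "m \<ge> 3" and k: "k > 0"
  shows "hom_count F (disjoint_copies k (cycle_graph m)) = hom_count F (cycle_graph (k * m))"
proof (rule hom_count_cycle_copies_if_lifts[OF F m k])
  fix b assume b: "b \<in> graph_homs F (cycle_graph m)"
  have fin: "finite (pverts F)" using F by (simp add: simple_graph_iff)
  then have "card (b ` pverts F) < card {..<m}"
    using card card_image_le[OF fin, of b] by simp
  then have "\<not> {..<m} \<subseteq> b ` pverts F"
    using card_mono[OF finite_imageI[OF fin]] by (meson leD)
  then obtain w where "w < m" "w \<notin> b ` pverts F" by auto
  then show "\<exists>p. is_lift k (closing_voltage m) F b p"
    using is_lift_closing_voltage_if_not_surj[OF b F m] by blast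
qed

lemma hom_count_cycle_copies_if_bipartite:
  fixes F :: "'a pair_pre_digraph"
  assumes F: "simple_graph F" "bipartite F" and m: "odd m" "m \<ge> 3"
  shows "hom_count F (disjoint_copies 2 (cycle_graph m)) = hom_count F (cycle_graph (2 * m))"
proof (rule hom_count_cycle_copies_if_lifts[OF F(1) m(2)])
  fix b assume b: "b \<in> graph_homs F (cycle_graph m)"
  obtain c :: "'a \<Rightarrow> bool" where c: "\<And>x y. (x, y) \<in> parcs F \<Longrightarrow> c x \<noteq> c y"
    using F(2) unfolding bipartite_def by blast
  have "is_lift 2 (closing_voltage m) F b (\<lambda>x. b x + of_bool (c x))"
    using b F(1) m(2)
  proof (rule is_lift_closing_voltageI)
    fix x y assume xy: "(x, y) \<in> parcs F"
    show "[b x + of_bool (c x) = b y + of_bool (c y)] (mod 2)" if "b y = b x + 1"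
      using that c[OF xy] by (cases "c x") (auto simp: cong_def mod_2_eq_odd)
    show "[b x + of_bool (c x) + 1 = b y + of_bool (c y)] (mod 2)" if "b x + 1 = m" "b y = 0"
    proof -
      have "even (b x)" using m(1) that(1) by auto
      then show ?thesis using that(2) c[OF xy] by (cases "c x") (auto simp: cong_def mod_2_eq_odd)
    qed
  qed
  then show "\<exists>p. is_lift 2 (closing_voltage m) F b p" by blast
qed simp

subsection \<open>Two queries\<close>

lemma ex_copies_with_hom_count_cycle:
  assumes H: "simple_graph H" and q: "odd q" "q \<ge> 3"
  obtains k m where "k * m = 6 * q" "k \<ge> 2" "m \<ge> q"
    "hom_count H (disjoint_copies k (cycle_graph m)) = hom_count H (cycle_graph (6 * q))"
proof (cases "bipartite H")
  case True
  then show thesis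
    using hom_count_cycle_copies_if_bipartite[OF H, of "3 * q"] q
    by (intro that[of 2 "3 * q"]) auto
next
  case False
  moreover have "bipartite (cycle_graph (6 * q))"
    "bipartite (disjoint_copies 3 (cycle_graph (2 * q)))"
    using q by (intro bipartite_cyclic_cover bipartite_cycle_graph simple_graph_cycle_graph; simp)+
  ultimately show thesis
    by (intro that[of 3 "2 * q"]) (simp_all add: hom_count_bipartite_eq_0)
qed

lemma ex_non_cycle_with_same_hom_counts:
  assumes F: "simple_graph F" "card (pverts F) < q" and H: "simple_graph H"
    and q: "odd q" "q \<ge> 3"
  obtains D :: "(nat \<times> nat) pair_pre_digraph" where "simple_graph D" "\<not> is_cycle D"
    "hom_count F D = hom_count F (cycle_graph (6 * q))"
    "hom_count H D = hom_count H (cycle_graph (6 * q))"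
proof -
  obtain k m where km: "k * m = 6 * q" "k \<ge> 2" "m \<ge> q"
    and count_H: "hom_count H (disjoint_copies k (cycle_graph m)) =
      hom_count H (cycle_graph (6 * q))"
    using H q by (rule ex_copies_with_hom_count_cycle)
  have cycle_m: "simple_graph (cycle_graph m)"
    using km q by (intro simple_graph_cycle_graph) simp
  show thesis
  proof
    show "simple_graph (disjoint_copies k (cycle_graph m))"
      using cycle_m km by (intro simple_graph_cyclic_cover) auto
    show "\<not> is_cycle (disjoint_copies k (cycle_graph m))"
      using cycle_m km(2) by (rule not_is_cycle_disjoint_copies)
    show "hom_count F (disjoint_copies k (cycle_graph m)) = hom_count F (cycle_graph (6 * q))"
      using hom_count_cycle_copies_if_card_less[OF F(1), of m k] F(2) km q by simp
  qed (rule count_H)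
qed

theorem theorem8p9:
  shows "\<not> (\<exists>F N X. adaptive_hom_algorithm 2 cycle_class F N X)"
proof
  assume "\<exists>F N X. adaptive_hom_algorithm 2 cycle_class F N X"
  then obtain F N X where alg: "adaptive_hom_algorithm 2 cycle_class F N X" by blast
  then have F: "simple_graph F" and N: "simple_graph (N [n])" for n
    by (simp_all add: adaptive_hom_algorithm_def)
  define q where "q = 2 * card (pverts F) + 3"
  have q: "card (pverts F) < q" "odd q" "q \<ge> 3" by (auto simp: q_def)
  let ?C = "cycle_graph (6 * q)"
  have C: "simple_graph ?C" "is_cycle ?C"
    using q by (auto intro: simple_graph_cycle_graph is_cycle_cycle_graph)
  obtain D :: "(nat \<times> nat) pair_pre_digraph" where D: "simple_graph D" "\<not> is_cycle D"
    "hom_count F D = hom_count F ?C"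
    "hom_count (N [hom_count F ?C]) D = hom_count (N [hom_count F ?C]) ?C"
    using F q(1) N q(2,3) by (rule ex_non_cycle_with_same_hom_counts)
  then have "hom_answers F N D 2 = hom_answers F N ?C 2"
    by (simp add: numeral_2_eq_2 Let_def)
  then show False
    using is_cycle_iff_hom_answers[OF alg D(1)] is_cycle_iff_hom_answers[OF alg C(1)] C(2) D(2)
    by simp
qed

end
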